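(* The set $$\{f\in C[0,1]: \lambda(\{y\in\mathbb{R}: f^{-1}(y)\text{ is a singleton}\})>0\}$$ is non-shy in $C[0,1]$.
   Context: Shyness: for an abelian Polish group $G$, a set $A\subset G$ is shy if there exist a Borel set $B\supset A$ in $G$ and a Borel probability measure $\nu$ on $G$ with $\nu(B+x)=0$ for all $x\in G$; non-shy means not shy. $C[0,1]$ is the Banach space of continuous functions $[0,1]\to\mathbb{R}$ with the maximum norm (an abelian Polish group under addition). $\lambda$ is one-dimensional Lebesgue measure. *)

theory Defs
  imports "HOL-Probability.Probability"
begin

typedef unit_interval = "{0..1::real}"
  by (rule exI[of _ 0]) simp

text \<open>The metric on \<^typ>\<open>unit_interval\<close> is the one inherited from the reals.\<close>

instantiation unit_interval :: metric_space
begin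

definition dist_unit_interval :: "unit_interval \<Rightarrow> unit_interval \<Rightarrow> real"
  where "dist_unit_interval x y = dist (Rep_unit_interval x) (Rep_unit_interval y)"

definition uniformity_unit_interval :: "(unit_interval \<times> unit_interval) filter"
  where "uniformity_unit_interval = (INF e\<in>{0<..}. principal {(x, y). dist x y < e})"

definition open_unit_interval :: "unit_interval set \<Rightarrow> bool"
  where "open_unit_interval U \<longleftrightarrow>
    (\<forall>x\<in>U. eventually (\<lambda>(x', y). x' = x \<longrightarrow> y \<in> U) uniformity)"

instance
proof
  fix x y z :: unit_interval
  show "(dist x y = 0) = (x = y)"
    by (simp add: dist_unit_interval_def Rep_unit_interval_inject)
  show "dist x y \<le> dist x z + dist y z"
    by (simp add: dist_unit_interval_def dist_triangle2)
qed (fact uniformity_unit_interval_def open_unit_interval_def)+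

end

lemma continuous_on_Rep_unit_interval: "continuous_on S Rep_unit_interval"
  by (auto simp: continuous_on_iff dist_unit_interval_def)

lemma continuous_on_Abs_unit_interval: "continuous_on {0..1} Abs_unit_interval"
  by (auto simp: continuous_on_iff dist_unit_interval_def Abs_unit_interval_inverse)

lemma compact_UNIV_unit_interval: "compact (UNIV :: unit_interval set)"
proof -
  have "(UNIV :: unit_interval set) = Abs_unit_interval ` {0..1}"
    by (metis (no_types, lifting) type_definition.Abs_image type_definition_unit_interval)
  then show ?thesis
    using compact_continuous_image[OF continuous_on_Abs_unit_interval] by simp
qed

text \<open>
  The space $C[0,1]$ is the Banach space \<^typ>\<open>unit_interval \<Rightarrow>\<^sub>C real\<close> with the supremum norm:
  boundedness is automatic by compactness.
\<close>

lemma bcontfun_unit_interval_iff: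
  fixes f :: "unit_interval \<Rightarrow> real"
  shows "f \<in> bcontfun \<longleftrightarrow> continuous_on UNIV f"
  using compact_imp_bounded[OF compact_continuous_image[OF _ compact_UNIV_unit_interval]]
  by (auto simp: bcontfun_def)

text \<open>
  Shyness is meant for abelian Polish groups. The definition uses only the group structure and
  the Borel sets. Translates of Borel sets are Borel, so the measure of \<open>B + x\<close> is never a
  default value.
\<close>

definition shy :: "'a::topological_ab_group_add set \<Rightarrow> bool"
  where "shy A \<longleftrightarrow>
    (\<exists>B \<nu>. A \<subseteq> B \<and> B \<in> sets borel \<and> prob_space \<nu> \<and> sets \<nu> = sets borel \<and>
       (\<forall>x. emeasure \<nu> ((\<lambda>b. b + x) ` B) = 0))"

end

theory Submission
  imports Defs
begin

text \<open>
  Every Borel probability measure on $C[0,1]$ charges a set of functions with a common modulus of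
  continuity $\omega$, so it suffices to translate such a set into the given one. The translating
  function is a multiple of a continuous nondecreasing $f$ with a left inverse $h$ that is
  extremely flat at all points of a set $Q$ of positive measure: for $y \in Q$ and $x = h(y)$, the
  increments of $f$ from $x$ dominate those permitted by $\omega$. Hence for all $g$ with modulus
  $\omega$ the value of $f + g$ at $h(y)$ is taken only there, and $y \mapsto (f + g)(h(y))$ is
  expanding on $Q$, so its image has positive measure. The function $h$ is a sum of small jumps at
  the rationals, and $Q$ omits a neighbourhood of each rational that is large compared with the
  jump there.
\<close>

section \<open>Charged sets with a common modulus of continuity\<close>

text \<open>By continuity from below, \<open>m n\<close> can be chosen so that the complement of
  \<open>E n (m n)\<close> has probability below \<open>(1/2)^(n + 2)\<close>. These bounds sum to
  1/2, so countable subadditivity leaves probability at least 1/2 for the intersection.\<close>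

lemma (in prob_space) incseq_INT_prob_pos:
  fixes E :: "nat \<Rightarrow> nat \<Rightarrow> 'a set"
  assumes E: "\<And>n m. E n m \<in> events"
    and inc: "\<And>n. incseq (E n)"
    and un: "\<And>n. (\<Union>m. E n m) = space M"
  obtains m where "prob (\<Inter>n. E n (m n)) > 0"
proof -
  have "\<exists>m. prob (space M - E n m) < (1/2)^(n + 2)" for n
  proof -
    have "(\<lambda>m. prob (E n m)) \<longlonglongrightarrow> prob (\<Union>m. E n m)"
      using E inc by (intro finite_Lim_measure_incseq) auto
    then have "(\<lambda>m. prob (E n m)) \<longlonglongrightarrow> 1"
      by (simp add: un prob_space)
    then have "\<forall>\<^sub>F m in sequentially. 1 - (1/2)^(n + 2) < prob (E n m)"
      by (rule order_tendstoD) simp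
    then obtain m where "1 - (1/2)^(n + 2) < prob (E n m)"
      using eventually_happens'[OF sequentially_bot] by blast
    then show ?thesis
      using prob_compl[OF E[of n m]] by (intro exI[of _ m]) linarith
  qed
  then obtain m where m: "\<And>n. prob (space M - E n (m n)) < (1/2)^(n + 2)"
    by metis
  have sums: "(\<lambda>n. (1/2::real)^(n + 2)) sums (1/2)"
    using sums_mult[OF power_half_series, of "1/2"] by simp
  have summ: "summable (\<lambda>n. prob (space M - E n (m n)))"
    by (rule summable_comparison_test'[OF sums_summable[OF sums], of 0]) (use less_imp_le[OF m] in simp)
  have "prob (\<Union>n. space M - E n (m n)) \<le> (\<Sum>n. prob (space M - E n (m n)))"
    using E summ by (intro finite_measure_subadditive_countably) auto
  also have "\<dots> \<le> (\<Sum>n. (1/2)^(n + 2))"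
    by (intro suminf_le summ sums_summable[OF sums] less_imp_le[OF m])
  also have "\<dots> = 1/2"
    using sums by (rule sums_unique[symmetric])
  finally have le: "prob (\<Union>n. space M - E n (m n)) \<le> 1/2" .
  have eq: "(\<Inter>n. E n (m n)) = space M - (\<Union>n. space M - E n (m n))"
    using sets.sets_into_space[OF E] by blast
  have "prob (\<Inter>n. E n (m n)) > 0"
    unfolding eq using le E by (subst prob_compl) auto
  then show ?thesis by (rule that)
qed

lemma continuous_on_eval_bcontfun:
  fixes s :: "'a::topological_space"
  shows "continuous_on S (\<lambda>g :: 'a \<Rightarrow>\<^sub>C 'b::metric_space. apply_bcontfun g s)"
  unfolding continuous_on_iff using dist_fun_lt_imp_dist_val_lt by blast

text \<open>The modulus of continuity is encoded by its inverse at dyadic levels: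
  \<open>\<delta> n\<close> is a distance within which values differ by at most
  \<open>(1/2)^n\<close>. The norm bound controls pairs of points that are far apart. All
  inequalities are weak, which makes the class closed and hence Borel.\<close>

definition modulus_class :: "real \<Rightarrow> (nat \<Rightarrow> real) \<Rightarrow> ('a::metric_space \<Rightarrow>\<^sub>C 'b::real_normed_vector) set"
  where "modulus_class M \<delta> = {g. norm g \<le> M \<and>
    (\<forall>n s t. dist s t \<le> \<delta> n \<longrightarrow> norm (apply_bcontfun g s - apply_bcontfun g t) \<le> (1/2)^n)}"

text \<open>On a compact domain every \<open>g\<close> is bounded and uniformly continuous. Hence
  for fixed \<open>n\<close> the closed sets \<open>E n m\<close> exhaust the space as
  \<open>m\<close> grows: the norm bound relaxes while the distance \<open>1 / (m + 1)\<close>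
  shrinks. One \<open>m n\<close> for each \<open>n\<close> then leaves an intersection of positive
  probability.\<close>

lemma modulus_class_charged:
  fixes \<nu> :: "('a::metric_space \<Rightarrow>\<^sub>C 'b::real_normed_vector) measure"
  assumes cpt: "compact (UNIV :: 'a set)" and "prob_space \<nu>" and sets: "sets \<nu> = sets borel"
  obtains M \<delta> where "M \<ge> 0" "\<And>n. \<delta> n > 0" "emeasure \<nu> (modulus_class M \<delta>) > 0"
proof -
  interpret prob_space \<nu> by fact
  define E where "E n m = {g :: 'a \<Rightarrow>\<^sub>C 'b. norm g \<le> real m \<and> (\<forall>s t. dist s t \<le> 1 / real (Suc m) \<longrightarrow>
    norm (apply_bcontfun g s - apply_bcontfun g t) \<le> (1/2)^n)}" for n m
  have space: "space \<nu> = UNIV"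
    using sets_eq_imp_space_eq[OF sets] by simp
  have closed: "closed (E n m)" for n m
  proof -
    have "E n m = {g. norm g \<le> real m} \<inter> (\<Inter>(s, t) \<in> {(s, t). dist s t \<le> 1 / real (Suc m)}.
      {g. norm (apply_bcontfun g s - apply_bcontfun g t) \<le> (1/2)^n})"
      by (auto simp: E_def)
    moreover have "closed {g :: 'a \<Rightarrow>\<^sub>C 'b. norm g \<le> real m}"
      by (intro closed_Collect_le continuous_intros)
    moreover have "closed {g :: 'a \<Rightarrow>\<^sub>C 'b. norm (apply_bcontfun g s - apply_bcontfun g t) \<le> (1/2)^n}" for s t
      by (intro closed_Collect_le continuous_intros continuous_on_eval_bcontfun)
    ultimately show ?thesis
      by (auto intro!: closed_INT)
  qed
  have inc: "incseq (E n)" for n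
  proof (rule incseq_SucI)
    fix m
    have "1 / real (Suc (Suc m)) \<le> 1 / real (Suc m)"
      by (intro divide_left_mono) auto
    then show "E n m \<le> E n (Suc m)"
      unfolding E_def by (auto intro: order_trans)
  qed
  have un: "(\<Union>m. E n m) = space \<nu>" for n
  proof -
    have "\<exists>m. g \<in> E n m" for g
    proof -
      have "uniformly_continuous_on UNIV (apply_bcontfun g)"
        by (intro compact_uniformly_continuous cpt) simp
      then obtain d where d: "d > 0" "\<And>s t. dist s t < d \<Longrightarrow> dist (apply_bcontfun g s) (apply_bcontfun g t) < (1/2)^n"
        unfolding uniformly_continuous_on_def
        by (metis UNIV_I zero_less_power half_gt_zero_iff zero_less_one)
      obtain a where a: "1 / real (Suc a) < d"
        using nat_approx_posE[OF d(1)] by auto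
      obtain b where b: "norm g \<le> real b"
        using real_arch_simple by blast
      define m where "m = max a b"
      have "1 / real (Suc m) \<le> 1 / real (Suc a)"
        by (intro divide_left_mono) (auto simp: m_def)
      then have "1 / real (Suc m) < d" "norm g \<le> real m"
        using a b by (auto simp: m_def)
      then have "g \<in> E n m"
        using d(2) unfolding E_def
        by (auto simp: dist_norm intro!: less_imp_le)
      then show ?thesis ..
    qed
    then show ?thesis by (auto simp: space)
  qed
  obtain m where m: "prob (\<Inter>n. E n (m n)) > 0"
    using incseq_INT_prob_pos[of E] closed inc un by (simp add: sets) blast
  define \<delta> where "\<delta> n = 1 / real (Suc (m n))" for n
  \<comment> \<open>A single norm bound suffices for the class, and the one coming from
    \<open>E 0 (m 0)\<close> is taken.\<close>
  have sub: "(\<Inter>n. E n (m n)) \<subseteq> modulus_class (real (m 0)) \<delta>"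
    by (auto simp: E_def modulus_class_def \<delta>_def)
  have "modulus_class (real (m 0)) \<delta> = {g. norm g \<le> real (m 0)} \<inter>
    (\<Inter>n. \<Inter>(s, t) \<in> {(s, t). dist s t \<le> \<delta> n}.
      {g. norm (apply_bcontfun g s - apply_bcontfun g t) \<le> (1/2)^n})"
    by (auto simp: modulus_class_def)
  moreover have "closed \<dots>"
    by (auto intro!: closed_INT closed_Int closed_Collect_le continuous_intros continuous_on_eval_bcontfun)
  ultimately have "closed (modulus_class (real (m 0)) \<delta> :: ('a \<Rightarrow>\<^sub>C 'b) set)"
    by (rule ssubst)
  then have "modulus_class (real (m 0)) \<delta> \<in> events"
    by (simp add: sets borel_closed)
  then have "prob (\<Inter>n. E n (m n)) \<le> prob (modulus_class (real (m 0)) \<delta>)"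
    by (intro finite_measure_mono sub)
  with m have "emeasure \<nu> (modulus_class (real (m 0)) \<delta>) > 0"
    by (simp add: emeasure_eq_measure)
  then show ?thesis
    by (intro that[of "real (m 0)" \<delta>]) (auto simp: \<delta>_def)
qed

section \<open>Singleton fibers of a continuous function\<close>

text \<open>A value has a singleton fiber iff it is attained, but not at two points at distance at
  least \<open>1 / (n + 1)\<close> for any \<open>n\<close>. Fixing this gap makes the set
  \<open>D n\<close> of such pairs compact, so the values to be removed from the compact range form
  a countable union of compact sets.\<close>

lemma borel_singleton_fibers:
  fixes f :: "'a::metric_space \<Rightarrow> 'b::metric_space"
  assumes cpt: "compact (UNIV :: 'a set)" and f: "continuous_on UNIV f"
  shows "{y. is_singleton (f -` {y})} \<in> sets borel"
proof -
  define D where "D n = {p :: 'a \<times> 'a. 1 / real (Suc n) \<le> dist (fst p) (snd p)} \<inter>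
    {p. f (fst p) = f (snd p)}" for n
  have "closed (D n)" for n
    unfolding D_def
    by (intro closed_Int closed_Collect_le closed_Collect_eq continuous_intros
        continuous_on_compose2[OF f]) auto
  moreover have "compact (UNIV :: ('a \<times> 'a) set)"
    using compact_Times[OF cpt cpt] by simp
  ultimately have "compact (D n)" for n
    using compact_Int_closed[of UNIV "D n"] by simp
  then have cD: "compact ((\<lambda>p. f (fst p)) ` D n)" for n
    by (intro compact_continuous_image continuous_on_compose2[OF f] continuous_intros) auto
  have "{y. is_singleton (f -` {y})} = range f - (\<Union>n. (\<lambda>p. f (fst p)) ` D n)" (is "?L = ?R")
  proof (intro equalityI subsetI)
    fix y assume "y \<in> ?L"
    then obtain x where x: "f -` {y} = {x}"
      by (auto simp: is_singleton_def)
    have "y \<noteq> f (fst p)" if "p \<in> D n" for n p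
    proof
      assume "y = f (fst p)"
      then have "fst p \<in> f -` {y}" "snd p \<in> f -` {y}"
        using that by (auto simp: D_def)
      then have "dist (fst p) (snd p) = 0"
        unfolding x by simp
      moreover have "1 / real (Suc n) \<le> dist (fst p) (snd p)"
        using that by (simp add: D_def)
      moreover have "1 / real (Suc n) > 0"
        by simp
      ultimately show False by linarith
    qed
    moreover have "y \<in> range f"
    proof -
      have "x \<in> f -` {y}" by (simp add: x)
      then show ?thesis by auto
    qed
    ultimately show "y \<in> ?R" by blast
  next
    fix y assume y: "y \<in> ?R"
    then obtain x where x: "y = f x" by blast
    have "z = x" if z: "f z = y" for z
    proof (rule ccontr)
      assume "z \<noteq> x"
      then obtain n where "1 / real (Suc n) < dist z x"
        using nat_approx_posE[of "dist z x"] by auto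
      then have "(z, x) \<in> D n"
        using z x by (simp add: D_def)
      then have "y \<in> (\<lambda>p. f (fst p)) ` D n"
        using z by (intro image_eqI[of _ _ "(z, x)"]) auto
      then show False
        using y by auto
    qed
    then have "f -` {y} = {x}" using x by auto
    then show "y \<in> ?L" by simp
  qed
  moreover have "range f \<in> sets borel"
    by (intro borel_closed compact_imp_closed compact_continuous_image f cpt)
  moreover have "(\<Union>n. (\<lambda>p. f (fst p)) ` D n) \<in> sets borel"
    using borel_closed[OF compact_imp_closed[OF cD]] by blast
  ultimately show ?thesis
    by (simp only: sets.Diff)
qed

section \<open>A function that is steep at many points\<close>

text \<open>The inverse is the generalized one, the supremum of all \<open>w\<close> with
  \<open>h w \<le> x\<close>, which is constant across the jumps of \<open>h\<close>. It is
  continuous because it is nondecreasing and onto. The last two conclusions turn bounds on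
  \<open>f x\<close> into bounds on \<open>x\<close> even when \<open>x\<close> lies in a jump
  gap.\<close>

lemma strict_mono_left_inverse:
  fixes h :: "real \<Rightarrow> real"
  assumes h: "strict_mono h" and lo: "\<And>x. \<exists>w. h w \<le> x" and hi: "\<And>x. \<exists>w. x < h w"
  obtains f where "continuous_on UNIV f" "\<And>w. f (h w) = w"
    "\<And>w x. w < f x \<Longrightarrow> h w \<le> x" "\<And>w x. f x < w \<Longrightarrow> x < h w"
proof -
  define f where "f x = Sup {w. h w \<le> x}" for x
  have bdd: "bdd_above {w. h w \<le> x}" for x
  proof -
    obtain v where "x < h v" using hi by blast
    then have "w \<le> v" if "h w \<le> x" for w
      using that strict_mono_less_eq[OF h, of v w] by linarith
    then show ?thesis by (auto simp: bdd_above_def)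
  qed
  have ne: "{w. h w \<le> x} \<noteq> {}" for x
    using lo by auto
  have fh: "f (h w) = w" for w
  proof -
    have "{v. h v \<le> h w} = {..w}"
      by (auto simp: strict_mono_less_eq[OF h])
    then show ?thesis by (simp add: f_def)
  qed
  have 1: "h w \<le> x" if w: "w < f x" for w x
  proof -
    obtain v where "h v \<le> x" "w < v"
      using w less_cSup_iff[OF ne bdd, of w x] by (auto simp: f_def)
    then show ?thesis
      using strict_monoD[OF h, of w v] by linarith
  qed
  have 2: "x < h w" if "f x < w" for w x
  proof (rule ccontr)
    assume "\<not> x < h w"
    then have "w \<le> f x"
      unfolding f_def by (intro cSup_upper bdd) auto
    then show False using that by simp
  qed
  have "continuous_on UNIV f"
  proof (rule continuous_onI_mono)
    have "surj f"
      using fh by (metis surjI)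
    then show "open (range f)" by simp
    show "f x \<le> f y" if "x \<le> y" for x y
      unfolding f_def using that by (intro cSup_subset_mono ne bdd) auto
  qed
  then show ?thesis using fh 1 2 by (rule that)
qed

text \<open>A point \<open>y\<close> of \<open>Q\<close> has distance at least
  \<open>(1/2)^(k + 3)\<close> from the rational \<open>q k\<close>. So only jumps with
  \<open>n < k + 3\<close> can occur within distance \<open>(1/2)^n\<close> of \<open>y\<close>, and
  the sizes \<open>a k\<close> are chosen so that all of these together amount to at most
  \<open>\<delta> n\<close>.\<close>

lemma ex_jump_function:
  fixes \<delta> :: "nat \<Rightarrow> real"
  assumes \<delta>: "\<And>n. \<delta> n > 0"
  obtains J :: "real \<Rightarrow> real" and Q where
    "strict_mono J" "\<And>w. J w \<in> {0..1}"
    "Q \<subseteq> {1..2}" "\<not> negligible Q"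
    "\<And>n y w. y \<in> Q \<Longrightarrow> \<bar>w - y\<bar> < (1/2)^n \<Longrightarrow> \<bar>J w - J y\<bar> \<le> \<delta> n"
proof -
  \<comment> \<open>This enumeration of the rationals may repeat values; a repeated rational merely
    receives the sum of the corresponding jumps.\<close>
  define q :: "nat \<Rightarrow> real" where "q k = of_rat (from_nat k)" for k
  have dense: "\<exists>k. a < q k \<and> q k < b" if "a < b" for a b
    using of_rat_dense[OF that] surj_from_nat[where 'a = rat] unfolding q_def surj_def by metis
  \<comment> \<open>The minimum runs over exactly those \<open>n\<close> for which a bound by
    \<open>\<delta> n\<close> may be demanded of the jump at \<open>q k\<close>, the entry 1 keeps
    the total at most 1, and the factors \<open>(1/2)^Suc k\<close> sum to 1.\<close>
  define a where "a k = (1/2)^Suc k * Min (insert 1 (\<delta> ` {..k + 3}))" for k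
  have a_pos: "a k > 0" for k
    unfolding a_def using \<delta> by (intro mult_pos_pos) (auto simp: Min_gr_iff)
  have a_le: "a k \<le> (1/2)^Suc k * \<delta> n" if "n \<le> k + 3" for k n
    unfolding a_def using that by (intro mult_left_mono Min_le) auto
  have a_le1: "a k \<le> (1/2)^Suc k" for k
    unfolding a_def using mult_left_mono[of "Min (insert 1 (\<delta> ` {..k + 3}))" 1 "(1/2::real)^Suc k"]
    by (simp add: Min_le_iff)
  have summ: "summable (\<lambda>k. a k * of_bool (P k))" for P
    using a_pos a_le1 by (intro summable_comparison_test'[OF sums_summable[OF power_half_series], of 0])
      (auto simp: less_imp_le abs_of_pos)
  define J where "J w = (\<Sum>k. a k * of_bool (q k < w))" for w
  have diff: "J w - J v = (\<Sum>k. a k * of_bool (v \<le> q k \<and> q k < w))" if "v \<le> w" for v w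
    unfolding J_def suminf_diff[OF summ summ] using that
    by (intro suminf_cong) auto
  have mono: "strict_mono J"
  proof (rule strict_monoI)
    fix v w :: real assume "v < w"
    then obtain k where "v < q k" "q k < w" using dense by blast
    then have "0 < (\<Sum>k. a k * of_bool (v \<le> q k \<and> q k < w))"
      using a_pos by (intro suminf_pos2[OF summ, of _ k]) (auto simp: less_imp_le)
    then show "J v < J w" using diff[of v w] \<open>v < w\<close> by linarith
  qed
  have range: "J w \<in> {0..1}" for w
  proof -
    have "J w \<le> (\<Sum>k. (1/2)^Suc k)"
      unfolding J_def using a_le1 by (intro suminf_le summ sums_summable[OF power_half_series]) auto
    also have "\<dots> = 1"
      using power_half_series by (rule sums_unique[symmetric])
    finally show ?thesis
      unfolding J_def using a_pos by (auto intro!: suminf_nonneg summ simp: less_imp_le)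
  qed
  \<comment> \<open>The intervals have lengths \<open>(1/2)^(k + 2)\<close>, which sum to 1/2, less
    than the length of \<open>{1..2}\<close>.\<close>
  define U where "U = (\<Union>k. {q k - (1/2)^(k + 3)<..<q k + (1/2)^(k + 3)})"
  define Q where "Q = {1..2} - U"
  have "emeasure lborel U \<le> (\<Sum>k. emeasure lborel {q k - (1/2)^(k + 3)<..<q k + (1/2)^(k + 3)})"
    unfolding U_def by (intro emeasure_subadditive_countably) auto
  also have "\<dots> = (\<Sum>k. ennreal (1/2 * (1/2)^Suc k))"
    by (intro suminf_cong) (simp add: power_add field_simps)
  also have "\<dots> = ennreal (1/2)"
    using sums_mult[OF power_half_series, of "1/2"] by (intro suminf_ennreal_eq) auto
  finally have U: "emeasure lborel U \<le> ennreal (1/2)" .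
  have "\<not> negligible Q"
  proof
    assume "negligible Q"
    moreover have bU: "U \<in> sets borel"
      unfolding U_def by auto
    then have bQ: "Q \<in> sets borel"
      unfolding Q_def by auto
    ultimately have Q0: "emeasure lborel Q = 0"
      by (auto simp: negligible_iff_null_sets null_sets_def)
    have "emeasure lborel {1..2::real} \<le> emeasure lborel (Q \<union> U)"
      using bU bQ by (intro emeasure_mono) (auto simp: Q_def)
    also have "\<dots> \<le> emeasure lborel Q + emeasure lborel U"
      using bU bQ by (intro emeasure_subadditive) auto
    also have "\<dots> \<le> ennreal (1/2)"
      using U by (simp add: Q0)
    finally have "ennreal 1 \<le> ennreal (1/2)"
      by (simp only: emeasure_lborel_Icc) simp
    then show False
      by (subst (asm) ennreal_le_iff) auto
  qed
  moreover have "\<bar>J w - J y\<bar> \<le> \<delta> n" if y: "y \<in> Q" and w: "\<bar>w - y\<bar> < (1/2)^n" for n y w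
  proof -
    have jump: "(\<Sum>k. a k * of_bool (P k)) \<le> \<delta> n" if P: "\<And>k. P k \<Longrightarrow> \<bar>q k - y\<bar> < (1/2)^n" for P
    proof -
      have "a k * of_bool (P k) \<le> (1/2)^Suc k * \<delta> n" for k
      proof (cases "P k")
        case True
        have "y \<notin> {q k - (1/2)^(k + 3)<..<q k + (1/2)^(k + 3)}"
          using y unfolding Q_def U_def by blast
        then have "(1/2)^(k + 3) \<le> \<bar>q k - y\<bar>"
          unfolding greaterThanLessThan_iff by linarith
        then have "(1/2::real)^(k + 3) < (1/2)^n"
          using P[OF True] by linarith
        then have "n < k + 3"
          by (subst (asm) power_strict_decreasing_iff) auto
        then show ?thesis
          using a_le[of n k] True by simp
      qed (use \<delta>[of n] in simp)
      then have "(\<Sum>k. a k * of_bool (P k)) \<le> (\<Sum>k. (1/2)^Suc k * \<delta> n)"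
        by (intro suminf_le summ summable_mult2 sums_summable[OF power_half_series])
      also have "\<dots> = \<delta> n"
        using sums_mult2[OF power_half_series, of "\<delta> n"] by (simp add: sums_iff)
      finally show ?thesis .
    qed
    show ?thesis
    proof (cases "y \<le> w")
      case True
      then have "J y \<le> J w"
        using mono by (simp add: strict_mono_less_eq)
      moreover have "J w - J y \<le> \<delta> n"
        unfolding diff[OF True] using w by (intro jump) auto
      ultimately show ?thesis by simp
    next
      case False
      then have "J w \<le> J y"
        using mono by (simp add: strict_mono_less_eq)
      moreover have "J y - J w \<le> \<delta> n"
        using False w by (subst diff) (auto intro!: jump)
      ultimately show ?thesis by simp
    qed
  qed
  ultimately show ?thesis
    using mono range by (intro that[of J Q]) (auto simp: Q_def)
qed

text \<open>Flatness of the jump function at \<open>y\<close> becomes steepness of its left inverse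
  \<open>f\<close> at \<open>h y\<close>: values of \<open>f\<close> close to \<open>y\<close> are
  taken only very close to \<open>h y\<close>.\<close>

lemma ex_steep_function:
  fixes \<delta> :: "nat \<Rightarrow> real"
  assumes \<delta>: "\<And>n. \<delta> n > 0"
  obtains f h :: "real \<Rightarrow> real" and Q where
    "continuous_on UNIV f" "\<And>w. f (h w) = w"
    "\<not> negligible Q" "\<And>y. y \<in> Q \<Longrightarrow> h y \<in> {0..1}"
    "\<And>n y z. y \<in> Q \<Longrightarrow> \<bar>f z - y\<bar> < (1/2)^n \<Longrightarrow> \<bar>z - h y\<bar> \<le> \<delta> n"
proof -
  obtain J :: "real \<Rightarrow> real" and Q where
    J: "strict_mono J" "\<And>w. J w \<in> {0..1}" and Q: "Q \<subseteq> {1..2}" "\<not> negligible Q"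
    and flat: "\<And>n y w. y \<in> Q \<Longrightarrow> \<bar>w - y\<bar> < (1/2)^n \<Longrightarrow> \<bar>J w - J y\<bar> \<le> \<delta> n"
    using ex_jump_function[of \<delta>] \<delta> by blast
  \<comment> \<open>The linear terms make \<open>h\<close> unbounded; they vanish within distance 1 of \<open>Q\<close>.\<close>
  define h where "h w = J w + min w 0 + max (w - 3) 0" for w
  have hJ: "h w = J w" if "w \<in> {0..3}" for w
    using that by (auto simp: h_def)
  have mono: "strict_mono h"
    unfolding h_def using strict_monoD[OF J(1)] by (intro strict_monoI) (smt (verit, best))
  have lo: "\<exists>w. h w \<le> x" for x
    using J(2)[of "- \<bar>x\<bar> - 1"] by (intro exI[of _ "- \<bar>x\<bar> - 1"]) (auto simp: h_def)
  have hi: "\<exists>w. x < h w" for x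
    using J(2)[of "\<bar>x\<bar> + 4"] by (intro exI[of _ "\<bar>x\<bar> + 4"]) (auto simp: h_def)
  obtain f where f: "continuous_on UNIV f" "\<And>w. f (h w) = w"
    and lt: "\<And>w x. w < f x \<Longrightarrow> h w \<le> x" and gt: "\<And>w x. f x < w \<Longrightarrow> x < h w"
    using strict_mono_left_inverse[OF mono lo hi] by blast
  have "\<bar>z - h y\<bar> \<le> \<delta> n" if y: "y \<in> Q" and z: "\<bar>f z - y\<bar> < (1/2)^n" for n y z
  proof -
    have n: "(1/2::real)^n \<le> 1"
      by (simp add: power_le_one)
    have hflat: "\<bar>h w - h y\<bar> \<le> \<delta> n" if "\<bar>w - y\<bar> < (1/2)^n" for w
    proof -
      have "w \<in> {0..3}" "y \<in> {0..3}"
        using that n y Q by force+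
      then show ?thesis using flat[OF y that] by (simp add: hJ)
    qed
    have "y - (1/2)^n < f z" "f z < y + (1/2)^n"
      using z by auto
    \<comment> \<open>Since \<open>z\<close> may lie in a jump gap, \<open>h (f z)\<close> need not
      equal \<open>z\<close>. Instead \<open>z\<close> is squeezed between \<open>h u\<close> and
      \<open>h v\<close>, both of which are within \<open>\<delta> n\<close> of
      \<open>h y\<close>.\<close>
    then obtain u v where u: "y - (1/2)^n < u" "u < f z" and v: "f z < v" "v < y + (1/2)^n"
      using dense by meson
    have "h u \<le> z" "z < h v"
      using lt[OF u(2)] gt[OF v(1)] .
    moreover have "\<bar>h u - h y\<bar> \<le> \<delta> n" "\<bar>h v - h y\<bar> \<le> \<delta> n"
      using u v z by (auto intro!: hflat)
    ultimately show ?thesis by linarith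
  qed
  moreover have "h y \<in> {0..1}" if "y \<in> Q" for y
  proof -
    have "y \<in> {0..3}" using that Q(1) by force
    then show ?thesis using hJ J(2) by metis
  qed
  ultimately show ?thesis
    using f Q(2) by (intro that[of f h Q]) auto
qed

section \<open>Translating a modulus class\<close>

text \<open>The inverse of \<open>\<phi>\<close> on the image is Lipschitz with constant
  \<open>1 / c\<close>, and Lipschitz maps preserve negligible sets. Thus a negligible image would
  make \<open>Q\<close> negligible.\<close>

lemma not_negligible_expanding_image:
  fixes \<phi> :: "real \<Rightarrow> real"
  assumes Q: "\<not> negligible Q" and c: "c > 0"
    and exp: "\<And>x y. x \<in> Q \<Longrightarrow> y \<in> Q \<Longrightarrow> c * \<bar>x - y\<bar> \<le> \<bar>\<phi> x - \<phi> y\<bar>"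
  shows "\<not> negligible (\<phi> ` Q)"
proof
  assume neg: "negligible (\<phi> ` Q)"
  have "inj_on \<phi> Q"
    using exp c by (intro inj_onI) (smt (verit, best) mult_pos_pos)
  then have inv: "inv_into Q \<phi> (\<phi> x) = x" if "x \<in> Q" for x
    using that by simp
  have "\<bar>x - y\<bar> \<le> 1 / c * \<bar>\<phi> x - \<phi> y\<bar>" if "x \<in> Q" "y \<in> Q" for x y
    using exp[OF that] c by (simp add: field_simps)
  then have "negligible (inv_into Q \<phi> ` \<phi> ` Q)"
    using inv by (intro negligible_locally_Lipschitz_image neg)
      (auto simp: abs_minus_commute intro!: exI[of _ UNIV] exI[of _ "1 / c"])
  moreover have "inv_into Q \<phi> ` \<phi> ` Q = Q"
    using inv by force
  ultimately show False using Q by simp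
qed

text \<open>The translate is \<open>C * f\<close> restricted to the unit interval, and one choice
  serves the whole class. Relative to the point \<open>h y\<close>, with \<open>y\<close> in
  \<open>Q\<close>, the change in \<open>g\<close> uses up at most half of the change in
  \<open>C * f\<close>, so \<open>g + F\<close> still moves by at least the other half.\<close>

lemma ex_translate_modulus_class:
  assumes M: "M \<ge> 0" and \<delta>: "\<And>n. \<delta> n > 0"
  obtains F :: "unit_interval \<Rightarrow>\<^sub>C real" where
    "\<And>g. g \<in> modulus_class M \<delta> \<Longrightarrow>
      emeasure lebesgue {y. is_singleton (apply_bcontfun (g + F) -` {y})} > 0"
proof -
  \<comment> \<open>The sequence \<open>\<delta>\<close> need not tend to 0. The minimum with
    \<open>(1/2)^n\<close> ensures that \<open>f z = y\<close> forces \<open>z = h y\<close>, by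
    letting \<open>n\<close> grow.\<close>
  obtain f h :: "real \<Rightarrow> real" and Q where
    f: "continuous_on UNIV f" "\<And>w. f (h w) = w"
    and Q: "\<not> negligible Q" "\<And>y. y \<in> Q \<Longrightarrow> h y \<in> {0..1}"
    and steep': "\<And>n y z. y \<in> Q \<Longrightarrow> \<bar>f z - y\<bar> < (1/2)^n \<Longrightarrow> \<bar>z - h y\<bar> \<le> min (\<delta> n) ((1/2)^n)"
    using ex_steep_function[of "\<lambda>n. min (\<delta> n) ((1/2)^n)"] \<delta> by auto
  have steep: "\<bar>z - h y\<bar> \<le> \<delta> n" "\<bar>z - h y\<bar> \<le> (1/2)^n" if "y \<in> Q" "\<bar>f z - y\<bar> < (1/2)^n" for n y z
    using steep'[OF that] by auto
  \<comment> \<open>Half of \<open>C\<close> is \<open>2 + 2 * M\<close>: the 2 absorbs the ratio of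
    consecutive dyadic scales when \<open>f\<close> is within 1 of \<open>y\<close>, and
    \<open>2 * M\<close> bounds the oscillation of \<open>g\<close> otherwise.\<close>
  define C where "C = 4 + 4 * M"
  have C: "C > 0" using M by (simp add: C_def)
  define F where "F = Bcontfun (\<lambda>s. C * f (Rep_unit_interval s))"
  have F: "apply_bcontfun F s = C * f (Rep_unit_interval s)" for s
    unfolding F_def
    by (subst Bcontfun_inverse)
      (auto simp: bcontfun_unit_interval_iff
        intro!: continuous_intros continuous_on_compose2[OF f(1)] continuous_on_Rep_unit_interval)
  have "emeasure lebesgue {y. is_singleton (apply_bcontfun (g + F) -` {y})} > 0"
    if g: "g \<in> modulus_class M \<delta>" for g
  proof -
    define p where "p y = Abs_unit_interval (h y)" for y
    have p: "Rep_unit_interval (p y) = h y" if "y \<in> Q" for y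
      using Q(2)[OF that] by (simp add: p_def Abs_unit_interval_inverse)
    have small: "\<bar>apply_bcontfun g s - apply_bcontfun g (p y)\<bar> \<le> C / 2 * \<bar>f (Rep_unit_interval s) - y\<bar>"
      if y: "y \<in> Q" and ne: "f (Rep_unit_interval s) \<noteq> y" for s y
    proof (cases "\<bar>f (Rep_unit_interval s) - y\<bar> < 1")
      case True
      define r where "r = \<bar>f (Rep_unit_interval s) - y\<bar>"
      have r: "0 < r" "r < 1" using ne True by (auto simp: r_def)
      have ex: "\<exists>n. (1/2)^n \<le> r"
        using real_arch_pow_inv[OF r(1), of "1/2"] by (auto intro: less_imp_le)
      \<comment> \<open>Since \<open>r < 1\<close>, the least such \<open>n\<close> is a successor
        \<open>Suc k\<close>, and \<open>r < (1/2)^k \<le> 2 * r\<close>. Steepness is applied at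
        the scale \<open>k\<close>, which exceeds \<open>r\<close> by a factor of at most 2.\<close>
      define n where "n = (LEAST n. (1/2)^n \<le> r)"
      have n: "(1/2)^n \<le> r"
        unfolding n_def by (rule LeastI_ex[OF ex])
      then obtain k where k: "n = Suc k"
        using r by (cases n) auto
      then have rk: "r < (1/2)^k"
        using not_less_Least[of k "\<lambda>n. (1/2)^n \<le> r"] by (auto simp: n_def)
      have "dist s (p y) \<le> \<delta> k"
        using steep(1)[OF y, of "Rep_unit_interval s" k] rk
        by (simp add: dist_unit_interval_def p[OF y] dist_real_def r_def)
      then have "\<bar>apply_bcontfun g s - apply_bcontfun g (p y)\<bar> \<le> (1/2)^k"
        using g by (simp add: modulus_class_def)
      also have "\<dots> \<le> 2 * r"
        using n by (simp add: k)
      also have "\<dots> \<le> C / 2 * r"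
        using M r by (intro mult_right_mono) (auto simp: C_def)
      finally show ?thesis by (simp add: r_def)
    next
      case False
      have "norm g \<le> M" using g by (simp add: modulus_class_def)
      then have "\<bar>apply_bcontfun g s - apply_bcontfun g (p y)\<bar> \<le> 2 * M"
        using norm_bounded[of g s] norm_bounded[of g "p y"] by simp
      also have "\<dots> \<le> C / 2 * 1"
        by (simp add: C_def)
      also have "\<dots> \<le> C / 2 * \<bar>f (Rep_unit_interval s) - y\<bar>"
        using False C by (intro mult_left_mono) auto
      finally show ?thesis .
    qed
    define G where "G = apply_bcontfun (g + F)"
    have G: "G s = apply_bcontfun g s + C * f (Rep_unit_interval s)" for s
      by (simp add: G_def F)
    have Gp: "G (p y) = apply_bcontfun g (p y) + C * y" if "y \<in> Q" for y
      by (simp add: G p[OF that] f(2))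
    have expand: "C / 2 * \<bar>f (Rep_unit_interval s) - y\<bar> \<le> \<bar>G s - G (p y)\<bar>" if y: "y \<in> Q" for s y
    proof (cases "f (Rep_unit_interval s) = y")
      case False
      have "G s - G (p y) = (apply_bcontfun g s - apply_bcontfun g (p y)) + C * (f (Rep_unit_interval s) - y)"
        by (simp add: G[of s] Gp[OF y] algebra_simps)
      moreover have "\<bar>C * (f (Rep_unit_interval s) - y)\<bar> = C / 2 * \<bar>f (Rep_unit_interval s) - y\<bar> + C / 2 * \<bar>f (Rep_unit_interval s) - y\<bar>"
        using C by (simp add: abs_mult)
      ultimately show ?thesis
        using small[OF y False] by linarith
    qed simp
    have uniq: "s = p y" if y: "y \<in> Q" and eq: "G s = G (p y)" for s y
    proof -
      have fy: "f (Rep_unit_interval s) = y"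
        using expand[OF y, of s] eq C by (auto simp: mult_le_0_iff)
      have "\<bar>Rep_unit_interval s - h y\<bar> \<le> (1/2)^n" for n
        using steep(2)[OF y, of "Rep_unit_interval s" n] fy by simp
      then have "\<bar>Rep_unit_interval s - h y\<bar> \<le> 0"
        by (intro LIMSEQ_le_const[OF LIMSEQ_realpow_zero[of "1/2::real"]]) auto
      then have "Rep_unit_interval s = Rep_unit_interval (p y)"
        by (simp add: p[OF y])
      then show ?thesis by (simp add: Rep_unit_interval_inject)
    qed
    let ?S = "{y. is_singleton (G -` {y})}"
    have sub: "(\<lambda>y. G (p y)) ` Q \<subseteq> ?S"
    proof clarify
      fix y assume "y \<in> Q"
      then have "G -` {G (p y)} = {p y}" using uniq by auto
      then show "is_singleton (G -` {G (p y)})" by simp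
    qed
    have "\<not> negligible ((\<lambda>y. G (p y)) ` Q)"
    proof (rule not_negligible_expanding_image[OF Q(1), of "C / 2"])
      show "C / 2 * \<bar>x - y\<bar> \<le> \<bar>G (p x) - G (p y)\<bar>" if "x \<in> Q" "y \<in> Q" for x y
        using expand[OF that(2), of "p x"] by (simp add: p[OF that(1)] f(2))
    qed (use C in simp)
    then have "\<not> negligible ?S"
      using negligible_subset[OF _ sub] by blast
    \<comment> \<open>Positive measure requires measurability here: \<open>emeasure\<close> is 0 by
      default on non-measurable sets, even on non-negligible ones.\<close>
    moreover have "?S \<in> sets borel"
      unfolding G_def
      by (intro borel_singleton_fibers compact_UNIV_unit_interval continuous_on_apply_bcontfun)
    ultimately show ?thesis
      unfolding G_def by (auto simp: negligible_iff_null_sets null_sets_def zero_less_iff_neq_zero)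
  qed
  then show ?thesis by (rule that)
qed

theorem theorem5p4:
  shows "\<not> shy {f :: unit_interval \<Rightarrow>\<^sub>C real.
    emeasure lebesgue {y :: real. is_singleton (apply_bcontfun f -` {y})} > 0}"
proof
  let ?A = "{f :: unit_interval \<Rightarrow>\<^sub>C real.
    emeasure lebesgue {y :: real. is_singleton (apply_bcontfun f -` {y})} > 0}"
  assume "shy ?A"
  then obtain B and \<nu> :: "(unit_interval \<Rightarrow>\<^sub>C real) measure" where
    AB: "?A \<subseteq> B" and B: "B \<in> sets borel" and \<nu>: "prob_space \<nu>" "sets \<nu> = sets borel"
    and null: "\<And>x. emeasure \<nu> ((\<lambda>b. b + x) ` B) = 0"
    unfolding shy_def by auto
  obtain M \<delta> where M: "M \<ge> 0" "\<And>n. \<delta> n > 0" and pos: "emeasure \<nu> (modulus_class M \<delta>) > 0"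
    using modulus_class_charged[OF compact_UNIV_unit_interval \<nu>] by blast
  obtain F :: "unit_interval \<Rightarrow>\<^sub>C real" where
    F: "\<And>g. g \<in> modulus_class M \<delta> \<Longrightarrow>
      emeasure lebesgue {y. is_singleton (apply_bcontfun (g + F) -` {y})} > 0"
    using ex_translate_modulus_class[of M \<delta>] M by blast
  have sub: "(modulus_class M \<delta> :: (unit_interval \<Rightarrow>\<^sub>C real) set) \<subseteq> (\<lambda>b. b + - F) ` B"
  proof
    fix g :: "unit_interval \<Rightarrow>\<^sub>C real" assume "g \<in> modulus_class M \<delta>"
    then have "g + F \<in> B" using F AB by auto
    then show "g \<in> (\<lambda>b. b + - F) ` B"
      by (intro image_eqI[of _ _ "g + F"]) auto
  qed
  \<comment> \<open>Monotonicity of \<open>emeasure\<close> needs the larger set to be measurable;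
    the translate of \<open>B\<close> is its preimage under a continuous translation.\<close>
  have "(\<lambda>b. b + - F) ` B = (\<lambda>c. c + F) -` B \<inter> space borel"
    by (auto intro!: image_eqI[of _ _ "_ + F"])
  also have "\<dots> \<in> sets borel"
    using B by (intro measurable_sets[OF borel_measurable_continuous_onI]) (intro continuous_intros)+
  finally have "(\<lambda>b. b + - F) ` B \<in> sets \<nu>"
    by (simp add: \<nu>(2))
  then have "emeasure \<nu> (modulus_class M \<delta>) \<le> emeasure \<nu> ((\<lambda>b. b + - F) ` B)"
    by (intro emeasure_mono sub)
  then show False using pos null[of "- F"] by simp
qed

end
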